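(* Let $H=(V_H,E_H,w_H)$ be a non-covering hypergraph of rank $\Upsilon_H$, and let $\nu_2(H)$ be the second smallest eigenvalue of its normalized Laplacian $\mathcal{L}_H$. Then $$\frac{\nu_2(H)}{\Upsilon_H}\ \le\ \phi_h(H)\ \le\ \sqrt{(2-\nu_2(H))\,\nu_2(H)},$$ where $\phi_h(H)$ is the conductance of $H$.
   Context: A hypergraph $H=(V_H,E_H,w_H)$ consists of a nonempty finite vertex set $V_H$ with $n$ elements, a finite set $E_H\subseteq 2^{V_H}$ of hyperedges, each of size at least $2$, and a weight function $w_H:E_H\to[0,\infty)$. Hyperedges may have different sizes. The degree of $u$ is $d_H(u)=\sum_{e\in E_H:\,u\in e}w_H(e)$; all degrees are assumed positive. The rank $\Upsilon_H$ is the maximum size of a hyperedge. $H$ is covering if every pair of distinct vertices is contained in at least one hyperedge, and non-covering otherwise. For $S\subseteq V_H$ let $\mathrm{vol}_H(S)=\sum_{v\in S}d_H(v)$ and $\partial_h(S)=\{e\in E_H: e\cap S\ne\emptyset,\ e\cap(V_H\setminus S)\neq\emptyset\}$. The conductance of $S$ with $\emptyset\subsetneq S\subsetneq V_H$ is $$\phi_h(S)=\frac{\sum_{e\in\partial_h(S)}w_H(e)}{\min(\mathrm{vol}_H(S),\mathrm{vol}_H(V_H\setminus S))},$$ and $\phi_h(H)=\min_{\emptyset\subsetneq S\subsetneq V_H}\phi_h(S)$. The adjacency matrix is $A_H[u,v]=\sum_{e\in E_H:\{u,v\}\subseteq e}\frac{w_H(e)}{|e|-1}$ for $u\ne v$ and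 $A_H[u,u]=0$. $D_H$ is the diagonal matrix of degrees, $L_H=D_H-A_H$ is the Laplacian, and $\mathcal{L}_H=D_H^{-1/2}L_HD_H^{-1/2}$ is the normalized Laplacian, with eigenvalues $\nu_1(H)\le\nu_2(H)\le\dots\le\nu_n(H)$ counted with multiplicity. *)

theory Defs
  imports "HOL-Analysis.Analysis" "HOL-Computational_Algebra.Polynomial"
begin

text \<open>The vertex set is the universe of a finite type; this covers every nonempty finite vertex
  set. Only the values of the weight function on hyperedges are ever used.\<close>

record 'v hypergraph =
  edges :: "'v set set"
  weight :: "'v set \<Rightarrow> real"

definition hdegree :: "'v::finite hypergraph \<Rightarrow> 'v \<Rightarrow> real" where
  "hdegree H u = (\<Sum>e | e \<in> edges H \<and> u \<in> e. weight H e)"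

definition hypergraph :: "'v::finite hypergraph \<Rightarrow> bool" where
  "hypergraph H \<longleftrightarrow>
     (\<forall>e\<in>edges H. 2 \<le> card e) \<and> (\<forall>e\<in>edges H. 0 \<le> weight H e) \<and> (\<forall>u. 0 < hdegree H u)"

definition hrank :: "'v::finite hypergraph \<Rightarrow> nat" where
  "hrank H = Max (card ` edges H)"

definition covering :: "'v::finite hypergraph \<Rightarrow> bool" where
  "covering H \<longleftrightarrow> (\<forall>u v. u \<noteq> v \<longrightarrow> (\<exists>e\<in>edges H. {u, v} \<subseteq> e))"

definition vol :: "'v::finite hypergraph \<Rightarrow> 'v set \<Rightarrow> real" where
  "vol H S = (\<Sum>v\<in>S. hdegree H v)"

definition boundary :: "'v::finite hypergraph \<Rightarrow> 'v set \<Rightarrow> 'v set set" where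
  "boundary H S = {e \<in> edges H. e \<inter> S \<noteq> {} \<and> e \<inter> (UNIV - S) \<noteq> {}}"

definition set_conductance :: "'v::finite hypergraph \<Rightarrow> 'v set \<Rightarrow> real" where
  "set_conductance H S =
     (\<Sum>e\<in>boundary H S. weight H e) / min (vol H S) (vol H (UNIV - S))"

definition conductance :: "'v::finite hypergraph \<Rightarrow> real" where
  "conductance H = Min (set_conductance H ` {S. {} \<subset> S \<and> S \<subset> UNIV})"

definition adjacency :: "'v::finite hypergraph \<Rightarrow> real^'v^'v" where
  "adjacency H = (\<chi> u v. if u = v then 0
     else (\<Sum>e | e \<in> edges H \<and> {u, v} \<subseteq> e. weight H e / (real (card e) - 1)))"

definition diag :: "('v::finite \<Rightarrow> real) \<Rightarrow> real^'v^'v" where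
  "diag d = (\<chi> u v. if u = v then d u else 0)"

definition laplacian :: "'v::finite hypergraph \<Rightarrow> real^'v^'v" where
  "laplacian H = diag (hdegree H) - adjacency H"

definition normalized_laplacian :: "'v::finite hypergraph \<Rightarrow> real^'v^'v" where
  "normalized_laplacian H =
     diag (\<lambda>u. 1 / sqrt (hdegree H u)) ** laplacian H ** diag (\<lambda>u. 1 / sqrt (hdegree H u))"

definition charpoly :: "real^'n^'n \<Rightarrow> real poly" where
  "charpoly A = det (mat [:0, 1:] - map_matrix (\<lambda>a. [:a:]) A)"

text \<open>The real eigenvalues in increasing order, each repeated according to its multiplicity as a
  root of the characteristic polynomial. A symmetric matrix, such as the normalized Laplacian, has
  \<open>CARD('n)\<close> of them.\<close>

definition eigenvalues :: "real^'n^'n \<Rightarrow> real list" where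
  "eigenvalues A = sorted_list_of_multiset (proots (charpoly A))"

text \<open>Indices start at 1, whereas list positions start at 0.\<close>

definition nu :: "nat \<Rightarrow> 'v::finite hypergraph \<Rightarrow> real" where
  "nu k H = eigenvalues (normalized_laplacian H) ! (k - 1)"

end

theory Submission imports Defs begin

text \<open>The matrix \<^term>\<open>adjacency H\<close> is the adjacency matrix of an ordinary weighted graph on the
  same vertices, in which a hyperedge \<open>e\<close> spreads its weight over the pairs of its vertices. Since
  each vertex of \<open>e\<close> meets \<open>card e - 1\<close> such pairs, the graph has the degrees of \<open>H\<close>, so it also
  has its volumes and its normalized Laplacian. Only the cuts differ: a hyperedge of size \<open>m\<close>
  that is split into \<open>k\<close> and \<open>m - k\<close> vertices contributes its weight times
  \<open>k (m - k) / (m - 1)\<close>, a factor between \<open>1\<close> and \<open>m / 2\<close>. A graph cut is therefore at least the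
  weight of the hypergraph boundary and at most half the rank times that weight
  (\<open>boundary_weight_cut_bounds\<close>). This reduces both inequalities to facts about graphs.

  The lower bound is the easy half of Cheeger's inequality, \<open>\<nu>\<^sub>2 / 2 \<le> \<phi>\<close>, which results from
  inserting a centred indicator function into the Rayleigh quotient
  (\<open>rayleigh_cut_bound\<close>).

  The upper bound is the hard half in its sharp form, \<open>\<phi>\<^sup>2 \<le> (2 - \<nu>\<^sub>2) \<nu>\<^sub>2\<close>
  (\<open>cheeger_inequality\<close>). The positive part of an eigenvector, taken on the side of smaller volume,
  has a Rayleigh quotient \<open>R \<le> \<nu>\<^sub>2\<close>, and integrating the isoperimetric inequality over the
  level sets of its square, followed by the Cauchy-Schwarz inequality, gives \<open>\<phi>\<^sup>2 \<le> R (2 - R)\<close>.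
  Replacing \<open>R\<close> by \<open>\<nu>\<^sub>2\<close> is legitimate because \<open>x (2 - x)\<close> increases on \<open>[0, 1]\<close> and \<open>\<nu>\<^sub>2 \<le> 1\<close>.
  The last inequality is where \<open>H\<close> being non-covering enters: two vertices without a common
  hyperedge support a test function with Rayleigh quotient exactly \<open>1\<close>
  (\<open>non_covering_nu_2_le_1\<close>).

  What links \<^const>\<open>nu\<close>, a root of a characteristic polynomial, to Rayleigh quotients is the
  spectral theorem for symmetric real matrices: an orthonormal eigenbasis that contains a given
  kernel vector determines the list of eigenvalues (\<open>second_eigenvalue_variational\<close>).\<close>

section \<open>The second eigenvalue of a positive semidefinite matrix\<close>

text \<open>By compactness the Rayleigh quotient attains its minimum \<open>m\<close> on the unit sphere of \<open>S\<close>,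
  and a minimizer is an eigenvector for \<open>m\<close>: otherwise moving it along the residual
  \<open>z = f x - m *\<^sub>R x\<close>, which stays in \<open>S\<close> by invariance, would lower the quotient.\<close>

lemma selfadjoint_eigenvector_in_invariant_subspace:
  fixes f :: "'a::euclidean_space \<Rightarrow> 'a"
  assumes f: "linear f" and sa: "\<And>x y. f x \<bullet> y = x \<bullet> f y"
    and S: "subspace S" and inv: "f ` S \<subseteq> S" and nz: "S \<noteq> {0}"
  obtains x m where "x \<in> S" "norm x = 1" "f x = m *\<^sub>R x"
proof -
  obtain s where s: "s \<in> S" "s \<noteq> 0"
    using nz subspace_0[OF S] by auto
  define C where "C = S \<inter> sphere 0 1"
  have "compact C"
    unfolding C_def using closed_subspace[OF S] by (simp add: closed_Int_compact)
  moreover have "s /\<^sub>R norm s \<in> C"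
    using s S by (simp add: C_def subspace_scale)
  then have "C \<noteq> {}" by auto
  moreover have "continuous_on C (\<lambda>x. x \<bullet> f x)"
    using f by (intro continuous_intros linear_continuous_on) (simp add: linear_linear)
  ultimately obtain x where x: "x \<in> C" and min: "\<And>y. y \<in> C \<Longrightarrow> x \<bullet> f x \<le> y \<bullet> f y"
    using continuous_attains_inf by metis
  define m where "m = x \<bullet> f x"
  have xS: "x \<in> S" and xx: "x \<bullet> x = 1" using x by (auto simp: C_def norm_eq_1)
  have ray: "m * (y \<bullet> y) \<le> y \<bullet> f y" if "y \<in> S" for y
  proof (cases "y = 0")
    case True
    then show ?thesis by simp
  next
    case False
    have "y /\<^sub>R norm y \<in> C"
      using that False S by (simp add: C_def subspace_scale)
    from min[OF this] have "m \<le> (y \<bullet> f y) / (norm y)\<^sup>2"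
      using f by (simp add: m_def linear_scale power2_eq_square divide_simps)
    then show ?thesis using False by (simp add: pos_le_divide_eq power2_norm_eq_inner)
  qed
  define z where "z = f x - m *\<^sub>R x"
  have zS: "z \<in> S" using xS inv S by (auto simp: z_def intro: subspace_diff subspace_scale)
  define q where "q = z \<bullet> f z - m * (z \<bullet> z)"
  \<comment> \<open>The nonnegative form \<open>y \<bullet> f y - m * (y \<bullet> y)\<close> vanishes at \<open>x\<close>, so along the line through
    \<open>x\<close> in direction \<open>z\<close> only the linear and the quadratic term remain.\<close>
  have quad: "0 \<le> 2 * t * (z \<bullet> z) + t\<^sup>2 * q" for t
  proof -
    have "x + t *\<^sub>R z \<in> S" using xS zS S by (simp add: subspace_add subspace_scale)
    from ray[OF this]
    have "0 \<le> (x + t *\<^sub>R z) \<bullet> f (x + t *\<^sub>R z) - m * ((x + t *\<^sub>R z) \<bullet> (x + t *\<^sub>R z))"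
      by simp
    also have "\<dots> = 2 * t * (z \<bullet> (f x - m *\<^sub>R x)) + t\<^sup>2 * q"
      using f sa[of x z] xx
      by (simp add: q_def linear_add linear_scale inner_add inner_diff_right m_def[symmetric]
          inner_commute[of z "f x"] inner_commute[of z x] algebra_simps power2_eq_square)
    finally show ?thesis by (simp add: z_def)
  qed
  have "z \<bullet> z = 0"
  proof (rule ccontr)
    assume "z \<bullet> z \<noteq> 0"
    then have zz: "z \<bullet> z > 0" by simp
    \<comment> \<open>A step against the gradient, short enough for the linear term to win.\<close>
    define t where "t = - (z \<bullet> z) / (\<bar>q\<bar> + 1)"
    have t: "t < 0" using zz by (simp add: t_def divide_neg_pos)
    have "- (t * q) \<le> \<bar>t\<bar> * \<bar>q\<bar>" by (metis abs_ge_minus_self abs_mult)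
    also have "\<dots> \<le> z \<bullet> z"
      using zz by (simp add: t_def divide_simps mult_left_mono)
    finally have "0 < 2 * (z \<bullet> z) + t * q" using zz by linarith
    then have "t * (2 * (z \<bullet> z) + t * q) < 0" using t by (simp add: mult_neg_pos)
    with quad[of t] show False by (simp add: algebra_simps power2_eq_square)
  qed
  then have "f x = m *\<^sub>R x" by (simp add: z_def)
  with xS xx show ?thesis by (intro that) (auto simp: norm_eq_1)
qed

lemma span_insert_unit_orthogonal:
  fixes x :: "'a::euclidean_space"
  assumes S: "subspace S" and x: "x \<in> S" "norm x = 1"
    and B: "span B = {y \<in> S. x \<bullet> y = 0}"
  shows "span (insert x B) = S"
proof
  have "B \<subseteq> S" using B span_superset[of B] by auto
  then show "span (insert x B) \<subseteq> S" using S x by (simp add: span_minimal)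
  show "S \<subseteq> span (insert x B)"
  proof
    fix y assume y: "y \<in> S"
    have "y - (x \<bullet> y) *\<^sub>R x \<in> span B"
      using y x S unfolding B
      by (auto intro: subspace_diff subspace_scale simp: inner_diff_right norm_eq_1)
    then show "y \<in> span (insert x B)" by (auto simp: span_insert)
  qed
qed

text \<open>Induction on the dimension: by self-adjointness, the orthogonal complement of an
  eigenvector within \<open>S\<close> is again invariant. The subspace is general, and not only the whole
  space, so that an eigenbasis can be required to extend a prescribed eigenvector.\<close>

lemma selfadjoint_orthonormal_eigenbasis:
  fixes f :: "'a::euclidean_space \<Rightarrow> 'a"
  assumes f: "linear f" and sa: "\<And>x y. f x \<bullet> y = x \<bullet> f y"
    and "subspace S" and "f ` S \<subseteq> S"
  shows "\<exists>B. span B = S \<and> pairwise orthogonal B \<and> (\<forall>b\<in>B. norm b = 1)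
    \<and> (\<forall>b\<in>B. \<exists>m. f b = m *\<^sub>R b)"
  using assms(3,4)
proof (induction "dim S" arbitrary: S rule: less_induct)
  case less
  show ?case
  proof (cases "S = {0}")
    case True
    then show ?thesis by (intro exI[of _ "{}"]) auto
  next
    case False
    obtain x m where x: "x \<in> S" "norm x = 1" "f x = m *\<^sub>R x"
      using selfadjoint_eigenvector_in_invariant_subspace[OF f sa less.prems False] by blast
    define T where "T = {y \<in> S. x \<bullet> y = 0}"
    have T: "subspace T"
      using less.prems(1) by (auto simp: T_def subspace_def inner_add_right)
    have "f ` T \<subseteq> T"
      using less.prems(2) x(3) by (auto simp: T_def sa[symmetric])
    moreover have "x \<bullet> x \<noteq> 0" using x(2) by auto
    then have "x \<notin> T" by (simp add: T_def)
    then have "T \<subset> S" using x(1) unfolding T_def by blast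
    then have "dim T < dim S"
      using T less.prems(1) by (metis dim_psubset span_eq_iff)
    ultimately obtain B where B: "span B = T" "pairwise orthogonal B" "\<forall>b\<in>B. norm b = 1"
        "\<forall>b\<in>B. \<exists>m. f b = m *\<^sub>R b"
      using less.hyps T by metis
    have "\<forall>b\<in>B. x \<bullet> b = 0" using B(1) span_superset[of B] by (auto simp: T_def)
    then have "pairwise orthogonal (insert x B)"
      using B(2) by (auto simp: pairwise_insert orthogonal_def inner_commute)
    then show ?thesis
      using span_insert_unit_orthogonal[OF less.prems(1) x(1,2), of B] B x
      by (intro exI[of _ "insert x B"]) (auto simp: T_def)
  qed
qed

text \<open>Let \<open>Q\<close> be the matrix whose columns are the eigenvectors. The equations \<open>A *v b = l b *\<^sub>R b\<close> say
  that \<open>(X - A) Q = Q D\<close> over the polynomial ring, where \<open>D\<close> is diagonal with entries \<open>X - l b\<close>.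
  Determinants are multiplicative over every commutative ring, and \<open>det Q\<close> cancels because \<open>Q\<close> is
  orthogonal.\<close>

lemma charpoly_orthonormal_eigenbasis:
  fixes A :: "real^'n^'n"
  assumes orth: "pairwise orthogonal B" and unit: "\<And>b. b \<in> B \<Longrightarrow> norm b = 1"
    and sp: "span B = UNIV" and ev: "\<And>b. b \<in> B \<Longrightarrow> A *v b = l b *\<^sub>R b"
  shows "charpoly A = (\<Prod>b\<in>B. [:- l b, 1:])"
proof -
  have "independent B"
    using orth unit by (intro pairwise_orthogonal_independent) force+
  then have "card B = CARD('n)" "finite B"
    using sp basis_card_eq_dim[of B UNIV] independent_bound by (auto simp: dim_UNIV)
  then obtain c :: "'n \<Rightarrow> real^'n" where c: "bij_betw c UNIV B"
    by (metis finite_same_card_bij finite)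
  then have cB: "c j \<in> B" for j
    by (auto simp: bij_betw_def)
  have inj: "c i = c j \<longleftrightarrow> i = j" for i j
    using c by (auto simp: bij_betw_def inj_eq)
  define Q :: "real^'n^'n" where "Q = (\<chi> i j. c j $ i)"
  have col: "column j Q = c j" for j by (simp add: column_def Q_def vec_eq_iff)
  have "orthogonal_matrix Q"
    using orth unit cB inj by (auto simp: orthogonal_matrix_orthonormal_columns col pairwise_def)
  then have "transpose Q ** Q = mat 1"
    by (simp add: orthogonal_matrix_def)
  then have QQ: "(\<Sum>k\<in>UNIV. Q $ k $ i * Q $ k $ j) = (if i = j then 1 else 0)" for i j
    by (simp add: vec_eq_iff matrix_matrix_mult_def transpose_def mat_def)
  let ?P = "map_matrix (\<lambda>a. [:a:]) Q :: real poly^'n^'n"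
  let ?D = "(\<chi> i j. if i = j then [:- l (c j), 1:] else 0) :: real poly^'n^'n"
  have "transpose ?P ** ?P = mat 1"
    by (simp add: vec_eq_iff matrix_matrix_mult_def transpose_def mat_def QQ sum_to_poly one_pCons)
  then have "det ?P * det ?P = 1"
    by (metis det_I det_mul det_transpose)
  then have nz: "det ?P \<noteq> 0" by auto
  have "(mat [:0, 1:] - map_matrix (\<lambda>a. [:a:]) A) ** ?P = ?P ** ?D"
  proof -
    have "(\<Sum>k\<in>UNIV. ((if i = k then [:0, 1:] else 0) - [:A $ i $ k:]) * [:Q $ k $ j:])
        = (\<Sum>k\<in>UNIV. [:Q $ i $ k:] * (if k = j then [:- l (c j), 1:] else 0))" for i j
    proof -
      have "(\<Sum>k\<in>UNIV. ((if i = k then [:0, 1:] else 0) - [:A $ i $ k:]) * [:Q $ k $ j:])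
          = (\<Sum>k\<in>UNIV. if i = k then [:0, 1:] * [:Q $ k $ j:] else 0)
            - (\<Sum>k\<in>UNIV. [:A $ i $ k * Q $ k $ j:])"
        unfolding sum_subtractf[symmetric] by (intro sum.cong) (auto simp: algebra_simps)
      also have "\<dots> = [:0, Q $ i $ j:] - [:(A *v c j) $ i:]"
        by (simp add: sum_to_poly matrix_vector_mult_def Q_def)
      also have "\<dots> = [:Q $ i $ j:] * [:- l (c j), 1:]"
        by (simp add: ev[OF cB] Q_def)
      also have "\<dots> = (\<Sum>k\<in>UNIV. if k = j then [:Q $ i $ k:] * [:- l (c j), 1:] else 0)"
        by simp
      also have "\<dots> = (\<Sum>k\<in>UNIV. [:Q $ i $ k:] * (if k = j then [:- l (c j), 1:] else 0))"
        by (intro sum.cong) auto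
      finally show ?thesis .
    qed
    then show ?thesis
      by (simp add: vec_eq_iff matrix_matrix_mult_def mat_def)
  qed
  then have "det (mat [:0, 1:] - map_matrix (\<lambda>a. [:a:]) A) * det ?P = det ?P * det ?D"
    by (simp only: det_mul[symmetric])
  then have "charpoly A = det ?D" using nz by (simp add: charpoly_def mult.commute)
  also have "\<dots> = (\<Prod>j\<in>UNIV. [:- l (c j), 1:])"
    by (subst det_diagonal) auto
  also have "\<dots> = (\<Prod>b\<in>B. [:- l b, 1:])"
    by (rule prod.reindex_bij_betw[OF c])
  finally show ?thesis .
qed

text \<open>Courant-Fischer for the second eigenvalue, when a kernel vector \<open>p\<close> of a positive
  semidefinite matrix is known. The complement of \<open>p\<close> has an orthonormal eigenbasis \<open>B\<close>, which
  \<open>p\<close> completes to an eigenbasis of the whole space. As \<open>p\<close> contributes the eigenvalue \<open>0\<close> and all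
  others are nonnegative, the second entry of the sorted list is the least eigenvalue on \<open>B\<close>.\<close>

lemma second_eigenvalue_variational:
  fixes A :: "real^'n^'n"
  assumes sym: "transpose A = A" and psd: "\<And>x. 0 \<le> x \<bullet> (A *v x)"
    and p: "A *v p = 0" "p \<noteq> 0" and n: "2 \<le> CARD('n)"
  defines "\<nu> \<equiv> eigenvalues A ! 1"
  shows "p \<bullet> x = 0 \<Longrightarrow> \<nu> * (x \<bullet> x) \<le> x \<bullet> (A *v x)"
    and "\<exists>x. x \<noteq> 0 \<and> p \<bullet> x = 0 \<and> A *v x = \<nu> *\<^sub>R x"
proof -
  have sa: "(A *v x) \<bullet> y = x \<bullet> (A *v y)" for x y
    using dot_lmul_matrix[of x A y] sym by (metis vector_transpose_matrix)
  define u where "u = p /\<^sub>R norm p"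
  have u: "norm u = 1" "A *v u = 0 *\<^sub>R u" using p by (auto simp: u_def matrix_vector_mult_scaleR)
  have pu: "p \<bullet> x = 0 \<longleftrightarrow> u \<bullet> x = 0" for x using p by (simp add: u_def)
  define S where "S = {y. u \<bullet> y = 0}"
  have "subspace S" by (auto simp: S_def subspace_def inner_add_right)
  moreover have "(*v) A ` S \<subseteq> S" using u(2) by (auto simp: S_def sa[symmetric])
  ultimately obtain B where B: "span B = S" "pairwise orthogonal B" "\<forall>b\<in>B. norm b = 1"
        "\<forall>b\<in>B. \<exists>m. A *v b = m *\<^sub>R b"
    using selfadjoint_orthonormal_eigenbasis[of "(*v) A" S] sa by auto
  have uB: "\<forall>b\<in>B. u \<bullet> b = 0" using B(1) span_superset[of B] by (auto simp: S_def)
  then have uB': "u \<notin> B" using u(1) by (metis inner_eq_zero_iff norm_zero zero_neq_one)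
  from B(4) obtain l0 where l0: "\<And>b. b \<in> B \<Longrightarrow> A *v b = l0 b *\<^sub>R b" by metis
  define l where "l = l0(u := 0)"
  have l: "A *v b = l b *\<^sub>R b" if "b \<in> B" for b using l0[OF that] that uB' by (auto simp: l_def)
  have lu: "l u = 0" by (simp add: l_def)
  have orth: "pairwise orthogonal (insert u B)"
    using B(2) uB by (auto simp: pairwise_insert orthogonal_def inner_commute)
  have sp: "span (insert u B) = UNIV"
    using B(1) u(1) by (intro span_insert_unit_orthogonal) (auto simp: S_def)
  have "independent (insert u B)"
    using orth B(3) u(1) by (intro pairwise_orthogonal_independent) force+
  then have "card (insert u B) = CARD('n)" and fin: "finite B"
    using sp basis_card_eq_dim[of "insert u B" UNIV] independent_bound[of "insert u B"]
    by (auto simp: dim_UNIV)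
  then have Bne: "B \<noteq> {}" using n by auto
  have "charpoly A = (\<Prod>b\<in>insert u B. [:- l b, 1:])"
    using orth sp B(3) u l lu by (intro charpoly_orthonormal_eigenbasis) auto
  then have "proots (charpoly A) = (\<Sum>b\<in>insert u B. {#l b#})"
    by (simp add: proots_prod del: prod.insert sum.insert)
  also have "\<dots> = add_mset 0 (\<Sum>b\<in>B. {#l b#})" using fin uB' lu by simp
  finally have eig: "eigenvalues A
      = insort 0 (sorted_list_of_multiset (\<Sum>b\<in>B. {#l b#}))" (is "_ = insort 0 ?L")
    by (simp add: eigenvalues_def)
  have setL: "set ?L = l ` B" using fin by (auto simp: set_mset_sum)
  have lpos: "0 \<le> l b" if "b \<in> B" for b
    using psd[of b] l[OF that] B(3) that by (simp add: norm_eq_1)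
  have "insort 0 ?L = 0 # ?L"
    using setL lpos by (intro insort_is_Cons) auto
  then have nu: "\<nu> = ?L ! 0" by (simp add: \<nu>_def eig)
  have Lne: "?L \<noteq> []" using setL Bne by (metis image_is_empty set_empty)
  then have "\<nu> \<in> l ` B" using nu setL nth_mem by (metis length_greater_0_conv)
  then obtain b where b: "b \<in> B" "\<nu> = l b" by auto
  have min: "\<nu> \<le> l b" if "b \<in> B" for b
  proof -
    have "l b \<in> set ?L" using setL that by auto
    then obtain i where "i < length ?L" "?L ! i = l b" by (metis in_set_conv_nth)
    then show ?thesis
      using sorted_nth_mono[OF sorted_sorted_list_of_multiset, of 0 i "\<Sum>b\<in>B. {#l b#}"] nu by simp
  qed
  have "b \<noteq> 0" using b(1) B(3) by auto
  then show "\<exists>x. x \<noteq> 0 \<and> p \<bullet> x = 0 \<and> A *v x = \<nu> *\<^sub>R x"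
    using b uB l pu by auto
  show "\<nu> * (x \<bullet> x) \<le> x \<bullet> (A *v x)" if "p \<bullet> x = 0"
  proof -
    have "x \<in> span B" using that B(1) pu by (auto simp: S_def)
    then have ex: "x = (\<Sum>b\<in>B. (x \<bullet> b) *\<^sub>R b)"
      using orthonormal_basis_expand[of B x] B fin by simp
    have "x \<bullet> x = x \<bullet> (\<Sum>b\<in>B. (x \<bullet> b) *\<^sub>R b)" using ex by simp
    then have xx: "x \<bullet> x = (\<Sum>b\<in>B. (x \<bullet> b)\<^sup>2)" by (simp add: inner_sum_right power2_eq_square)
    have "x \<bullet> (A *v x) = (A *v x) \<bullet> (\<Sum>b\<in>B. (x \<bullet> b) *\<^sub>R b)" using ex by (simp add: inner_commute)
    also have "\<dots> = (\<Sum>b\<in>B. l b * (x \<bullet> b)\<^sup>2)"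
      by (simp add: inner_sum_right sa l power2_eq_square mult_ac)
    finally show ?thesis
      unfolding xx sum_distrib_left using min by (auto intro!: sum_mono mult_right_mono)
  qed
qed

section \<open>Cheeger inequalities for weighted graphs\<close>

locale weighted_graph =
  fixes a :: "'v::finite \<Rightarrow> 'v \<Rightarrow> real"
  assumes sym: "a u v = a v u" and nonneg: "0 \<le> a u v"
begin

definition deg :: "'v \<Rightarrow> real" where "deg u = (\<Sum>v\<in>UNIV. a u v)"

definition cut :: "'v set \<Rightarrow> real" where "cut S = (\<Sum>u\<in>S. \<Sum>v\<in>-S. a u v)"

definition energy :: "('v \<Rightarrow> real) \<Rightarrow> real" where
  "energy g = (\<Sum>u\<in>UNIV. \<Sum>v\<in>UNIV. a u v * (g u - g v)\<^sup>2) / 2"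

lemma deg_nonneg: "0 \<le> deg u"
  by (simp add: deg_def nonneg sum_nonneg)

lemma energy_nonneg: "0 \<le> energy g"
  by (simp add: energy_def nonneg sum_nonneg)

lemma weighted_sum_swap: "(\<Sum>u\<in>UNIV. \<Sum>v\<in>UNIV. a u v * f v u) = (\<Sum>u\<in>UNIV. \<Sum>v\<in>UNIV. a u v * f u v)"
  by (subst sum.swap) (simp add: sym)

text \<open>Green's formula, or summation by parts: the energy is the quadratic form of the
  Laplacian.\<close>

lemma energy_green: "energy g = (\<Sum>u\<in>UNIV. g u * (\<Sum>v\<in>UNIV. a u v * (g u - g v)))"
proof -
  have "2 * energy g = (\<Sum>u\<in>UNIV. \<Sum>v\<in>UNIV. a u v * (g u * (g u - g v)))
      + (\<Sum>u\<in>UNIV. \<Sum>v\<in>UNIV. a u v * (g v * (g v - g u)))"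
    by (simp add: energy_def sum.distrib[symmetric] algebra_simps power2_eq_square)
  also have "\<dots> = 2 * (\<Sum>u\<in>UNIV. \<Sum>v\<in>UNIV. a u v * (g u * (g u - g v)))"
    unfolding weighted_sum_swap[of "\<lambda>u v. g u * (g u - g v)"] by simp
  also have "\<dots> = 2 * (\<Sum>u\<in>UNIV. g u * (\<Sum>v\<in>UNIV. a u v * (g u - g v)))"
    by (simp only: sum_distrib_left mult.left_commute)
  finally show ?thesis by simp
qed

text \<open>The parallelogram law, edge by edge. It expresses the sum of the squares \<open>(g u + g v)\<^sup>2\<close>
  through the energy; keeping this term exact is what produces the factor \<open>2 - \<nu>\<close>, and not
  merely \<open>2\<close>, in Cheeger's inequality.\<close>

lemma energy_add_signless:
  "energy g + (\<Sum>u\<in>UNIV. \<Sum>v\<in>UNIV. a u v * (g u + g v)\<^sup>2) / 2 = 2 * (\<Sum>u\<in>UNIV. deg u * (g u)\<^sup>2)"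
proof -
  have "(\<Sum>u\<in>UNIV. \<Sum>v\<in>UNIV. a u v * (g u - g v)\<^sup>2) + (\<Sum>u\<in>UNIV. \<Sum>v\<in>UNIV. a u v * (g u + g v)\<^sup>2)
      = (\<Sum>u\<in>UNIV. \<Sum>v\<in>UNIV. a u v * (2 * (g u)\<^sup>2)) + (\<Sum>u\<in>UNIV. \<Sum>v\<in>UNIV. a u v * (2 * (g v)\<^sup>2))"
    by (simp add: sum.distrib[symmetric] algebra_simps power2_eq_square)
  also have "\<dots> = 4 * (\<Sum>u\<in>UNIV. deg u * (g u)\<^sup>2)"
    unfolding weighted_sum_swap[of "\<lambda>u v. 2 * (g u)\<^sup>2"]
    by (simp add: deg_def sum_distrib_left sum_distrib_right mult_ac)
  finally show ?thesis by (simp add: energy_def)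
qed

lemma total_variation_indicator:
  "(\<Sum>u\<in>UNIV. \<Sum>v\<in>UNIV. a u v * \<bar>indicator S u - indicator S v\<bar>) = 2 * cut S"
proof -
  have c: "cut S = (\<Sum>u\<in>UNIV. \<Sum>v\<in>UNIV. a u v * (indicator S u * indicator (-S) v))"
  proof -
    have inner: "(\<Sum>v\<in>-S. a u v) = (\<Sum>v\<in>UNIV. a u v * indicator (-S) v)" for u
      by (rule sum.mono_neutral_cong_left) auto
    have "cut S = (\<Sum>u\<in>UNIV. indicator S u * (\<Sum>v\<in>UNIV. a u v * indicator (-S) v))"
      unfolding cut_def inner by (rule sum.mono_neutral_cong_left) auto
    then show ?thesis by (simp only: sum_distrib_left mult_ac)
  qed
  have "2 * cut S = (\<Sum>u\<in>UNIV. \<Sum>v\<in>UNIV. a u v * (indicator S u * indicator (-S) v))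
     + (\<Sum>u\<in>UNIV. \<Sum>v\<in>UNIV. a u v * (indicator S v * indicator (-S) u))"
    unfolding weighted_sum_swap[of "\<lambda>u v. indicator S u * indicator (-S) v"] c by simp
  also have "\<dots> = (\<Sum>u\<in>UNIV. \<Sum>v\<in>UNIV. a u v * \<bar>indicator S u - indicator S v\<bar>)"
    unfolding sum.distrib[symmetric] by (intro sum.cong) (auto simp: indicator_def)
  finally show ?thesis by simp
qed

lemma energy_indicator: "energy (\<lambda>u. t * indicator S u - s) = t\<^sup>2 * cut S"
proof -
  have "(t * indicator S u - s - (t * indicator S v - s))\<^sup>2
      = t\<^sup>2 * \<bar>indicator S u - indicator S v\<bar>" for u v :: 'v
    by (auto simp: indicator_def)
  then have "energy (\<lambda>u. t * indicator S u - s)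
      = (t\<^sup>2 * (\<Sum>u\<in>UNIV. \<Sum>v\<in>UNIV. a u v * \<bar>indicator S u - indicator S v\<bar>)) / 2"
    by (simp add: energy_def sum_distrib_left mult_ac)
  then show ?thesis unfolding total_variation_indicator by simp
qed

text \<open>The discrete coarea argument. The function \<open>F\<close> is a nonnegative combination of indicators of
  its level sets, and the total variation is additive over this nested combination, so the
  isoperimetric inequality for the level sets sums up. The induction removes one layer at a time:
  subtracting the least positive value \<open>m\<close> on the support \<open>S\<close> shrinks the support.\<close>

lemma level_set_inequality:
  assumes "\<And>u. 0 \<le> F u"
    and "\<And>S. S \<noteq> {} \<Longrightarrow> S \<subseteq> {u. 0 < F u} \<Longrightarrow> c * sum deg S \<le> cut S"
  shows "c * (\<Sum>u\<in>UNIV. deg u * F u) \<le> (\<Sum>u\<in>UNIV. \<Sum>v\<in>UNIV. a u v * \<bar>F u - F v\<bar>) / 2"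
  using assms
proof (induction "card {u. 0 < F u}" arbitrary: F rule: less_induct)
  case less
  define S where "S = {u. 0 < F u}"
  show ?case
  proof (cases "S = {}")
    case True
    then have "\<not> 0 < F u" for u by (auto simp: S_def)
    then have "F u = 0" for u using less.prems(1)[of u] by (metis order_le_imp_less_or_eq)
    then show ?thesis by simp
  next
    case False
    define m where "m = Min (F ` S)"
    have "m \<in> F ` S" using False by (simp add: m_def)
    then obtain w where w: "w \<in> S" "F w = m" by auto
    have m: "0 < m" using w by (auto simp: S_def)
    have mle: "m \<le> F u" if "u \<in> S" for u using that by (simp add: m_def)
    have F0: "F u = 0" if "u \<notin> S" for u using less.prems(1)[of u] that by (auto simp: S_def)
    define G where "G u = F u - m * indicator S u" for u
    have G0: "0 \<le> G u" for u
      using mle[of u] F0[of u] by (cases "u \<in> S") (auto simp: G_def)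
    have sub: "{u. 0 < G u} \<subseteq> S - {w}"
      using F0 w by (auto simp: G_def indicator_def split: if_splits)
    then have "card {u. 0 < G u} < card {u. 0 < F u}"
      using w by (intro psubset_card_mono) (auto simp: S_def)
    then have IH: "c * (\<Sum>u\<in>UNIV. deg u * G u) \<le> (\<Sum>u\<in>UNIV. \<Sum>v\<in>UNIV. a u v * \<bar>G u - G v\<bar>) / 2"
      using less.hyps[of G] G0 sub less.prems(2) unfolding S_def by blast
    have tv: "\<bar>F u - F v\<bar> = \<bar>G u - G v\<bar> + m * \<bar>indicator S u - indicator S v\<bar>" for u v
      using F0[of u] F0[of v] mle[of u] mle[of v] m by (auto simp: G_def indicator_def)
    have "deg u * F u = deg u * G u + m * (deg u * indicator S u)" for u
      by (simp add: G_def algebra_simps)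
    then have "(\<Sum>u\<in>UNIV. deg u * F u) = (\<Sum>u\<in>UNIV. deg u * G u) + m * (\<Sum>u\<in>UNIV. deg u * indicator S u)"
      by (simp only: sum.distrib sum_distrib_left)
    then have "c * (\<Sum>u\<in>UNIV. deg u * F u) = c * (\<Sum>u\<in>UNIV. deg u * G u) + m * (c * sum deg S)"
      by (simp add: algebra_simps indicator_def if_distrib sum.If_cases cong: if_cong)
    also have "\<dots> \<le> (\<Sum>u\<in>UNIV. \<Sum>v\<in>UNIV. a u v * \<bar>G u - G v\<bar>) / 2 + m * cut S"
      using IH less.prems(2)[OF False] m by (intro add_mono mult_left_mono) (auto simp: S_def)
    also have "\<dots> = ((\<Sum>u\<in>UNIV. \<Sum>v\<in>UNIV. a u v * \<bar>G u - G v\<bar>)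
        + m * (\<Sum>u\<in>UNIV. \<Sum>v\<in>UNIV. a u v * \<bar>indicator S u - indicator S v\<bar>)) / 2"
      unfolding total_variation_indicator by simp
    also have "\<dots> = (\<Sum>u\<in>UNIV. \<Sum>v\<in>UNIV. a u v * \<bar>F u - F v\<bar>) / 2"
      unfolding tv by (simp add: sum_distrib_left sum.distrib algebra_simps)
    finally show ?thesis .
  qed
qed

text \<open>Cheeger's inequality with a Dirichlet boundary condition: the isoperimetric inequality is
  imposed on the subsets of the support of \<open>g\<close>, among them all its level sets. The level sets of \<open>g\<^sup>2\<close>
  bound \<open>c * N\<close> by the sum of \<open>\<bar>g u - g v\<bar> * \<bar>g u + g v\<bar>\<close>, to which the Cauchy-Schwarz inequality
  applies.\<close>

lemma dirichlet_cheeger: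
  assumes g: "\<And>u. 0 \<le> g u" and c: "0 \<le> c"
    and iso: "\<And>S. S \<noteq> {} \<Longrightarrow> S \<subseteq> {u. 0 < g u} \<Longrightarrow> c * sum deg S \<le> cut S"
  defines "N \<equiv> \<Sum>u\<in>UNIV. deg u * (g u)\<^sup>2"
  shows "(c * N)\<^sup>2 \<le> energy g * (2 * N - energy g)"
proof -
  have N: "0 \<le> N" by (simp add: N_def sum_nonneg deg_nonneg)
  let ?V = "UNIV \<times> UNIV :: ('v \<times> 'v) set"
  have "c * N \<le> (\<Sum>u\<in>UNIV. \<Sum>v\<in>UNIV. a u v * \<bar>(g u)\<^sup>2 - (g v)\<^sup>2\<bar>) / 2"
    unfolding N_def using iso g
    by (intro level_set_inequality) (auto simp: subset_iff order_less_le)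
  also have "\<dots> = (\<Sum>(u,v)\<in>?V. (sqrt (a u v / 2) * \<bar>g u - g v\<bar>) * (sqrt (a u v / 2) * \<bar>g u + g v\<bar>))"
  proof -
    have "a u v * \<bar>(g u)\<^sup>2 - (g v)\<^sup>2\<bar> / 2
        = (sqrt (a u v / 2) * \<bar>g u - g v\<bar>) * (sqrt (a u v / 2) * \<bar>g u + g v\<bar>)" for u v
    proof -
      have "(g u)\<^sup>2 - (g v)\<^sup>2 = (g u - g v) * (g u + g v)"
        by (simp add: algebra_simps power2_eq_square)
      then have "\<bar>(g u)\<^sup>2 - (g v)\<^sup>2\<bar> = \<bar>g u - g v\<bar> * \<bar>g u + g v\<bar>" by (simp add: abs_mult)
      moreover define r where "r = sqrt (a u v / 2)"
      moreover have "a u v = 2 * r * r" using nonneg[of u v] by (simp add: r_def mult.assoc)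
      ultimately show ?thesis by simp
    qed
    then show ?thesis by (simp only: sum_divide_distrib sum.cartesian_product[symmetric])
  qed
  finally have "(c * N)\<^sup>2 \<le> (\<Sum>(u,v)\<in>?V. (sqrt (a u v / 2) * \<bar>g u - g v\<bar>) * (sqrt (a u v / 2) * \<bar>g u + g v\<bar>))\<^sup>2"
    using c N by (intro power_mono) auto
  also have "\<dots> \<le> (\<Sum>(u,v)\<in>?V. (sqrt (a u v / 2) * \<bar>g u - g v\<bar>)\<^sup>2) * (\<Sum>(u,v)\<in>?V. (sqrt (a u v / 2) * \<bar>g u + g v\<bar>)\<^sup>2)"
    unfolding case_prod_unfold by (rule Cauchy_Schwarz_ineq_sum)
  also have "(\<Sum>(u,v)\<in>?V. (sqrt (a u v / 2) * \<bar>g u - g v\<bar>)\<^sup>2) = energy g"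
    by (simp add: energy_def power_mult_distrib nonneg sum_divide_distrib flip: sum.cartesian_product del: UNIV_Times_UNIV)
  also have "(\<Sum>(u,v)\<in>?V. (sqrt (a u v / 2) * \<bar>g u + g v\<bar>)\<^sup>2) = 2 * N - energy g"
    using energy_add_signless[of g]
    by (simp add: N_def power_mult_distrib nonneg sum_divide_distrib flip: sum.cartesian_product del: UNIV_Times_UNIV)
  finally show ?thesis .
qed

text \<open>Truncating an eigenfunction does not increase its Rayleigh quotient: where \<open>g\<close> is positive,
  replacing the negative neighbours by \<open>0\<close> only decreases \<open>g u - g v\<close>.\<close>

lemma energy_positive_part:
  assumes "\<And>u. (\<Sum>v\<in>UNIV. a u v * (g u - g v)) = \<nu> * deg u * g u"
  shows "energy (\<lambda>u. max (g u) 0) \<le> \<nu> * (\<Sum>u\<in>UNIV. deg u * (max (g u) 0)\<^sup>2)"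
proof -
  let ?p = "\<lambda>u. max (g u) 0"
  have "energy ?p = (\<Sum>u\<in>UNIV. ?p u * (\<Sum>v\<in>UNIV. a u v * (?p u - ?p v)))"
    by (rule energy_green)
  also have "\<dots> \<le> (\<Sum>u\<in>UNIV. ?p u * (\<Sum>v\<in>UNIV. a u v * (g u - g v)))"
  proof (intro sum_mono)
    fix u
    show "?p u * (\<Sum>v\<in>UNIV. a u v * (?p u - ?p v)) \<le> ?p u * (\<Sum>v\<in>UNIV. a u v * (g u - g v))"
      by (cases "g u \<le> 0") (auto intro!: mult_left_mono sum_mono simp: nonneg max_def)
  qed
  also have "\<dots> = \<nu> * (\<Sum>u\<in>UNIV. deg u * (?p u)\<^sup>2)"
    unfolding assms sum_distrib_left by (intro sum.cong) (auto simp: max_def power2_eq_square)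
  finally show ?thesis .
qed

text \<open>The positive and the negative part of \<open>g\<close> are both nonzero by orthogonality to the constants,
  and the support of one of them has at most the volume of the other. That part satisfies the
  hypotheses of the preceding inequality, since for subsets of the smaller support the minimum of
  the two volumes is the volume of the subset itself. Both signs of \<open>g\<close> are treated by the same
  local statement \<open>half\<close>.\<close>

lemma cheeger_inequality:
  assumes deg: "\<And>u. 0 < deg u" and c: "0 \<le> c"
    and iso: "\<And>S. S \<noteq> {} \<Longrightarrow> S \<noteq> UNIV \<Longrightarrow> c * min (sum deg S) (sum deg (- S)) \<le> cut S"
    and eig: "\<And>u. (\<Sum>v\<in>UNIV. a u v * (g u - g v)) = \<nu> * deg u * g u"
    and orth: "(\<Sum>u\<in>UNIV. deg u * g u) = 0" and nz: "g \<noteq> (\<lambda>u. 0)" and nu: "\<nu> \<le> 1"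
  shows "c\<^sup>2 \<le> (2 - \<nu>) * \<nu>"
proof -
  have half: "c\<^sup>2 \<le> (2 - \<nu>) * \<nu>"
    if eig: "\<And>u. (\<Sum>v\<in>UNIV. a u v * (f u - f v)) = \<nu> * deg u * f u"
      and vol: "sum deg {u. 0 < f u} \<le> sum deg {u. f u < 0}" and w: "0 < f w" for f w
  proof -
    let ?p = "\<lambda>u. max (f u) 0"
    define N where "N = (\<Sum>u\<in>UNIV. deg u * (?p u)\<^sup>2)"
    have "0 < deg w * (?p w)\<^sup>2" using deg w by simp
    also have "\<dots> \<le> N"
      unfolding N_def by (intro member_le_sum) (auto simp: deg_nonneg)
    finally have N: "0 < N" .
    have pos: "{u. 0 < ?p u} = {u. 0 < f u}" by auto
    have small: "c * sum deg S \<le> cut S" if S: "S \<noteq> {}" "S \<subseteq> {u. 0 < f u}" for S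
    proof -
      have "sum deg S \<le> sum deg {u. 0 < f u}"
        using S by (intro sum_mono2) (auto simp: deg_nonneg)
      also note vol
      also have "sum deg {u. f u < 0} \<le> sum deg (- S)"
        using S by (intro sum_mono2) (auto simp: deg_nonneg subset_iff)
      finally have le: "sum deg S \<le> sum deg (- S)" .
      have "0 < sum deg S" using S deg by (intro sum_pos) auto
      with le have "S \<noteq> UNIV" by auto
      from iso[OF S(1) this] le show ?thesis by (simp add: min_absorb1)
    qed
    let ?E = "energy ?p"
    have CE: "(c * N)\<^sup>2 \<le> ?E * (2 * N - ?E)"
      unfolding N_def using small c by (intro dirichlet_cheeger) (auto simp: pos)
    have EN: "?E \<le> \<nu> * N"
      using energy_positive_part[OF eig] by (simp add: N_def)
    have "\<nu> * N \<le> N" using nu N by simp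
    \<comment> \<open>Monotonicity of \<open>x (2 - x)\<close> on \<open>[0, 1]\<close> as a product: the difference of the values at \<open>\<nu>\<close>
      and at \<open>?E / N\<close> factors as \<open>(\<nu> - ?E / N) (2 - \<nu> - ?E / N)\<close>.\<close>
    have "0 \<le> (\<nu> * N - ?E) * ((2 * N - \<nu> * N) - ?E)"
      using EN \<open>\<nu> * N \<le> N\<close> by (intro mult_nonneg_nonneg) auto
    then have "?E * (2 * N - ?E) \<le> (\<nu> * N) * (2 * N - \<nu> * N)"
      by (simp add: algebra_simps)
    with CE have "c\<^sup>2 * N\<^sup>2 \<le> ((2 - \<nu>) * \<nu>) * N\<^sup>2"
      by (simp add: algebra_simps power2_eq_square)
    then show ?thesis using N by simp
  qed
  have ex_pos: "\<exists>w. 0 < f w" if "(\<Sum>u\<in>UNIV. deg u * f u) = 0" "f \<noteq> (\<lambda>u. 0)" for f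
  proof (rule ccontr)
    assume "\<not> ?thesis"
    then have le: "f u \<le> 0" for u by (simp add: not_less)
    then have "\<forall>u\<in>UNIV. - (deg u * f u) = 0"
      using that(1) deg_nonneg
      by (subst sum_nonneg_eq_0_iff[symmetric]) (auto simp: sum_negf mult_nonneg_nonpos)
    then have "deg u * f u = 0" for u by simp
    then show False using that(2) deg by (metis less_irrefl mult_eq_0_iff)
  qed
  show ?thesis
  proof (cases "sum deg {u. 0 < g u} \<le> sum deg {u. g u < 0}")
    case True
    then show ?thesis using half[OF eig] ex_pos[OF orth nz] by blast
  next
    case False
    let ?f = "\<lambda>u. - g u"
    have "(\<Sum>v\<in>UNIV. a u v * (?f u - ?f v)) = - (\<Sum>v\<in>UNIV. a u v * (g u - g v))" for u
      unfolding sum_negf[symmetric] by (intro sum.cong) (auto simp: algebra_simps)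
    then have "(\<Sum>v\<in>UNIV. a u v * (?f u - ?f v)) = \<nu> * deg u * ?f u" for u
      by (simp add: eig)
    moreover have "\<exists>w. 0 < ?f w"
      using orth nz by (intro ex_pos) (auto simp: sum_negf fun_eq_iff)
    ultimately show ?thesis using half[of ?f] False by auto
  qed
qed

text \<open>The test function is a multiple of the indicator of \<open>S\<close>, shifted to be orthogonal to the
  constants. With \<open>x\<close> and \<open>y\<close> the volumes of \<open>S\<close> and of its complement, it gives
  \<open>\<nu> x y \<le> (x + y) cut S\<close>, and \<open>x y / (x + y)\<close> is at least half the smaller volume.\<close>

lemma rayleigh_cut_bound:
  assumes deg: "\<And>u. 0 < deg u" and nu: "0 \<le> \<nu>"
    and ray: "\<And>g. (\<Sum>u\<in>UNIV. deg u * g u) = 0 \<Longrightarrow> \<nu> * (\<Sum>u\<in>UNIV. deg u * (g u)\<^sup>2) \<le> energy g"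
    and S: "S \<noteq> {}" "S \<noteq> UNIV"
  shows "\<nu> * min (sum deg S) (sum deg (- S)) \<le> 2 * cut S"
proof -
  define x y where "x = sum deg S" and "y = sum deg (- S)"
  have "- S \<noteq> {}" using S by auto
  then have x: "0 < x" and y: "0 < y" using S deg by (auto simp: x_def y_def intro!: sum_pos)
  have split: "sum h UNIV = sum h S + sum h (- S)" for h :: "'v \<Rightarrow> real"
    by (metis Compl_eq_Diff_UNIV add.commute finite sum.subset_diff subset_UNIV)
  let ?g = "\<lambda>u. (x + y) * indicator S u - x :: real"
  have "(\<Sum>u\<in>UNIV. deg u * ?g u) = x * y + y * (- x)"
    unfolding split by (simp add: x_def y_def sum_distrib_right[symmetric] sum_negf)
  then have "\<nu> * (\<Sum>u\<in>UNIV. deg u * (?g u)\<^sup>2) \<le> (x + y)\<^sup>2 * cut S"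
    using ray[of ?g] unfolding energy_indicator by simp
  moreover have "(\<Sum>u\<in>UNIV. deg u * (?g u)\<^sup>2) = x * y\<^sup>2 + y * x\<^sup>2"
    unfolding split by (simp add: x_def y_def sum_distrib_right[symmetric])
  ultimately have "(\<nu> * (x * y)) * (x + y) \<le> ((x + y) * cut S) * (x + y)"
    by (simp add: algebra_simps power2_eq_square)
  then have 1: "\<nu> * (x * y) \<le> (x + y) * cut S"
    using x y by (simp only: mult_le_cancel_right)
  have "min x y * (x + y) \<le> 2 * (x * y)"
    using x y by (auto simp: min_def algebra_simps mult_left_mono)
  then have "\<nu> * (min x y * (x + y)) \<le> \<nu> * (2 * (x * y))" using nu by (rule mult_left_mono)
  with 1 have "(\<nu> * min x y) * (x + y) \<le> (2 * cut S) * (x + y)" by (simp add: algebra_simps)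
  then have "\<nu> * min x y \<le> 2 * cut S"
    using x y by (simp only: mult_le_cancel_right)
  then show ?thesis by (simp add: x_def y_def)
qed

end

section \<open>The weighted graph of a hypergraph\<close>

abbreviation adj :: "'v::finite hypergraph \<Rightarrow> 'v \<Rightarrow> 'v \<Rightarrow> real" where
  "adj H u v \<equiv> adjacency H $ u $ v"

text \<open>A form in which the summation range does not depend on the vertices, so that sums over
  vertices and over hyperedges can be exchanged.\<close>

lemma adjacency_edge_sum:
  "adj H u v
    = (\<Sum>e\<in>edges H. if u \<noteq> v \<and> u \<in> e \<and> v \<in> e then weight H e / (real (card e) - 1) else 0)"
proof (cases "u = v")
  case False
  then show ?thesis
    by (simp add: adjacency_def sum.inter_filter[symmetric])
qed (simp add: adjacency_def)

lemma weighted_graph_adjacency: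
  assumes "hypergraph H"
  shows "weighted_graph (adj H)"
proof
  fix u v
  show "adj H u v = adj H v u"
    unfolding adjacency_edge_sum by (intro sum.cong) auto
  show "0 \<le> adj H u v"
    unfolding adjacency_edge_sum using assms by (force simp: hypergraph_def intro!: sum_nonneg)
qed

text \<open>A vertex of \<open>e\<close> has \<open>card e - 1\<close> neighbours within \<open>e\<close>, each joined to it with weight
  \<open>weight H e / (card e - 1)\<close>.\<close>

lemma deg_adjacency:
  assumes H: "hypergraph H"
  shows "weighted_graph.deg (adj H) = hdegree H"
proof
  interpret weighted_graph "adj H" using H by (rule weighted_graph_adjacency)
  fix u
  have "(\<Sum>v\<in>UNIV. if u \<noteq> v \<and> u \<in> e \<and> v \<in> e then weight H e / (real (card e) - 1) else 0)
      = (if u \<in> e then weight H e else 0)" if e: "e \<in> edges H" for e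
  proof (cases "u \<in> e")
    case True
    have "2 \<le> card e" using e H by (simp add: hypergraph_def)
    have "(\<Sum>v\<in>UNIV. if u \<noteq> v \<and> u \<in> e \<and> v \<in> e then weight H e / (real (card e) - 1) else 0)
        = (\<Sum>v\<in>e - {u}. weight H e / (real (card e) - 1))"
      using True by (intro sum.mono_neutral_cong_right) auto
    also have "\<dots> = weight H e"
      using True \<open>2 \<le> card e\<close> by (simp add: of_nat_diff)
    finally show ?thesis using True by simp
  qed simp
  then have "deg u = (\<Sum>e\<in>edges H. if u \<in> e then weight H e else 0)"
    unfolding deg_def unfolding adjacency_edge_sum by (subst sum.swap) simp
  then show "deg u = hdegree H u"
    by (simp add: hdegree_def sum.inter_filter[symmetric])
qed

lemma cut_adjacency:
  assumes H: "hypergraph H"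
  shows "weighted_graph.cut (adj H) S
    = (\<Sum>e\<in>edges H. weight H e * (real (card (e \<inter> S)) * real (card (e - S)) / (real (card e) - 1)))"
proof -
  interpret weighted_graph "adj H" using H by (rule weighted_graph_adjacency)
  let ?a = "\<lambda>u v e. if u \<noteq> v \<and> u \<in> e \<and> v \<in> e then weight H e / (real (card e) - 1) else 0"
  have "(\<Sum>u\<in>S. \<Sum>v\<in>-S. ?a u v e)
      = weight H e * (real (card (e \<inter> S)) * real (card (e - S)) / (real (card e) - 1))" for e
  proof -
    let ?t = "weight H e / (real (card e) - 1)"
    have "(\<Sum>v\<in>-S. if u \<noteq> v \<and> u \<in> e \<and> v \<in> e then ?t else 0)
        = (if u \<in> e then real (card (e - S)) * ?t else 0)" if "u \<in> S" for u
    proof -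
      have "(\<Sum>v\<in>-S. if u \<noteq> v \<and> u \<in> e \<and> v \<in> e then ?t else 0)
          = (\<Sum>v\<in>e - S. if u \<in> e then ?t else 0)"
        using that by (intro sum.mono_neutral_cong_right) auto
      then show ?thesis by simp
    qed
    then have "(\<Sum>u\<in>S. \<Sum>v\<in>-S. if u \<noteq> v \<and> u \<in> e \<and> v \<in> e then ?t else 0)
        = (\<Sum>u\<in>S. if u \<in> e then real (card (e - S)) * ?t else 0)" by simp
    also have "\<dots> = (\<Sum>u\<in>e \<inter> S. real (card (e - S)) * ?t)"
      by (intro sum.mono_neutral_cong_right) auto
    finally show ?thesis by simp
  qed
  moreover have "cut S = (\<Sum>u\<in>S. \<Sum>v\<in>-S. \<Sum>e\<in>edges H. ?a u v e)"
    unfolding cut_def unfolding adjacency_edge_sum by simp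
  moreover have "\<dots> = (\<Sum>u\<in>S. \<Sum>e\<in>edges H. \<Sum>v\<in>-S. ?a u v e)"
    by (intro sum.cong refl sum.swap)
  moreover have "\<dots> = (\<Sum>e\<in>edges H. \<Sum>u\<in>S. \<Sum>v\<in>-S. ?a u v e)"
    by (rule sum.swap)
  ultimately show ?thesis by simp
qed

text \<open>For \<open>x, y \<ge> 1\<close> the lower bound on \<open>x y / (x + y - 1)\<close> is \<open>(x - 1) (y - 1) \<ge> 0\<close>, and the upper
  bound is equivalent to \<open>x + y \<le> x\<^sup>2 + y\<^sup>2\<close>.\<close>

lemma split_edge_ratio_bounds:
  fixes e S :: "'a::finite set"
  assumes "e \<inter> S \<noteq> {}" "e - S \<noteq> {}"
  defines "r \<equiv> real (card (e \<inter> S)) * real (card (e - S)) / (real (card e) - 1)"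
  shows "1 \<le> r" "r \<le> real (card e) / 2"
proof -
  define x y where "x = real (card (e \<inter> S))" and "y = real (card (e - S))"
  have "0 < card (e \<inter> S)" "0 < card (e - S)" using assms(1,2) by (simp_all add: card_gt_0_iff)
  then have x: "1 \<le> x" and y: "1 \<le> y" unfolding x_def y_def by linarith+
  have e: "real (card e) = x + y"
    using card_Int_Diff[of e S] by (simp add: x_def y_def)
  have "0 \<le> (x - 1) * (y - 1)" using x y by simp
  then show "1 \<le> r"
    using x y unfolding r_def e x_def[symmetric] y_def[symmetric] by (simp add: field_simps)
  have "x * 1 \<le> x * x" "y * 1 \<le> y * y" using x y by (intro mult_left_mono; simp)+
  then have "x + y \<le> x * x + y * y" by simp
  then show "r \<le> real (card e) / 2"
    using x y unfolding r_def e x_def[symmetric] y_def[symmetric] by (simp add: field_simps)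
qed

lemma boundary_weight_cut_bounds:
  assumes H: "hypergraph H"
  shows "(\<Sum>e\<in>boundary H S. weight H e) \<le> weighted_graph.cut (adj H) S"
    and "weighted_graph.cut (adj H) S \<le> real (hrank H) / 2 * (\<Sum>e\<in>boundary H S. weight H e)"
proof -
  let ?r = "\<lambda>e. real (card (e \<inter> S)) * real (card (e - S)) / (real (card e) - 1)"
  have bd: "e \<in> edges H \<and> e \<inter> S \<noteq> {} \<and> e - S \<noteq> {}" if "e \<in> boundary H S" for e
    using that by (auto simp: boundary_def)
  have cut: "weighted_graph.cut (adj H) S = (\<Sum>e\<in>boundary H S. weight H e * ?r e)"
    unfolding cut_adjacency[OF H]
    by (intro sum.mono_neutral_right) (auto simp: boundary_def)
  have w: "0 \<le> weight H e" if "e \<in> boundary H S" for e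
    using bd[OF that] H by (simp add: hypergraph_def)
  show "(\<Sum>e\<in>boundary H S. weight H e) \<le> weighted_graph.cut (adj H) S"
    unfolding cut
  proof (intro sum_mono)
    fix e assume e: "e \<in> boundary H S"
    show "weight H e \<le> weight H e * ?r e"
      using mult_left_mono[OF split_edge_ratio_bounds(1) w[OF e], of e S] bd[OF e] by simp
  qed
  show "weighted_graph.cut (adj H) S \<le> real (hrank H) / 2 * (\<Sum>e\<in>boundary H S. weight H e)"
    unfolding cut sum_distrib_left
  proof (intro sum_mono)
    fix e assume e: "e \<in> boundary H S"
    have "?r e \<le> real (card e) / 2" using bd[OF e] by (intro split_edge_ratio_bounds) auto
    also have "card e \<le> hrank H"
      using bd[OF e] by (simp add: hrank_def)
    finally have "?r e \<le> real (hrank H) / 2" by simp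
    from mult_left_mono[OF this w[OF e]]
    show "weight H e * ?r e \<le> real (hrank H) / 2 * weight H e" by (simp add: mult.commute)
  qed
qed

text \<open>The substitution \<open>x u = sqrt (d u) * g u\<close> turns the normalized Laplacian into the Laplacian
  of the weighted graph, which acts on \<open>g\<close> through the differences \<open>g u - g v\<close>.\<close>

lemma normalized_laplacian_apply:
  assumes H: "hypergraph H"
  shows "(normalized_laplacian H *v (\<chi> u. sqrt (hdegree H u) * g u)) $ u
    = (\<Sum>v\<in>UNIV. adj H u v * (g u - g v)) / sqrt (hdegree H u)"
proof -
  interpret weighted_graph "adj H" using H by (rule weighted_graph_adjacency)
  have pos: "0 < hdegree H v" for v using H by (simp add: hypergraph_def)
  let ?s = "\<lambda>u. sqrt (hdegree H u)"
  have "diag (\<lambda>u. 1 / ?s u) *v (\<chi> u. ?s u * g u) = (\<chi> u. g u)"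
    using pos[THEN less_imp_neq]
    by (simp add: vec_eq_iff diag_def matrix_vector_mult_def if_distribR if_distrib cong: if_cong)
  moreover have "(diag (\<lambda>u. 1 / ?s u) *v y) $ u = y $ u / ?s u" for y :: "real^'a"
    by (simp add: diag_def matrix_vector_mult_def if_distribR if_distrib cong: if_cong)
  moreover have "(laplacian H *v (\<chi> u. g u)) $ u = (\<Sum>v\<in>UNIV. adj H u v * (g u - g v))"
  proof -
    have "(laplacian H *v (\<chi> u. g u)) $ u
        = (\<Sum>v\<in>UNIV. (if u = v then hdegree H u else 0) * g v) - (\<Sum>v\<in>UNIV. adj H u v * g v)"
      by (simp add: laplacian_def diag_def matrix_vector_mult_def left_diff_distrib sum_subtractf)
    also have "(\<Sum>v\<in>UNIV. (if u = v then hdegree H u else 0) * g v) = deg u * g u"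
      by (simp add: deg_adjacency[OF H] if_distribR if_distrib cong: if_cong)
    finally show ?thesis
      by (simp add: deg_def sum_distrib_right right_diff_distrib sum_subtractf)
  qed
  ultimately show ?thesis
    by (simp add: normalized_laplacian_def matrix_vector_mul_assoc[symmetric])
qed

lemma transpose_normalized_laplacian:
  assumes H: "hypergraph H"
  shows "transpose (normalized_laplacian H) = normalized_laplacian H"
proof -
  have "transpose (diag d) = diag d" for d :: "'a \<Rightarrow> real"
    by (auto simp: transpose_def diag_def vec_eq_iff)
  moreover have "transpose (adjacency H) = adjacency H"
    using weighted_graph.sym[OF weighted_graph_adjacency[OF H]]
    by (simp add: transpose_def vec_eq_iff)
  then have "transpose (laplacian H) = laplacian H"
    by (auto simp: laplacian_def transpose_def diag_def vec_eq_iff)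
  ultimately show ?thesis
    by (simp add: normalized_laplacian_def matrix_transpose_mul matrix_mul_assoc)
qed

text \<open>The variational characterization in the coordinates \<open>g\<close>: the kernel vector
  \<open>(sqrt (d u))\<^sub>u\<close> corresponds to the constant function \<open>1\<close>, the Euclidean inner product to the inner
  product weighted by degrees, and the quadratic form to the energy.\<close>

lemma nu_2_variational:
  fixes H :: "'v::finite hypergraph"
  assumes H: "hypergraph H" and n: "2 \<le> CARD('v)"
  shows "(\<Sum>u\<in>UNIV. hdegree H u * g u) = 0 \<Longrightarrow>
      nu 2 H * (\<Sum>u\<in>UNIV. hdegree H u * (g u)\<^sup>2) \<le> weighted_graph.energy (adj H) g"
    and "\<exists>g. g \<noteq> (\<lambda>u. 0) \<and> (\<Sum>u\<in>UNIV. hdegree H u * g u) = 0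
      \<and> (\<forall>u. (\<Sum>v\<in>UNIV. adj H u v * (g u - g v)) = nu 2 H * hdegree H u * g u)"
proof -
  interpret weighted_graph "adj H" using H by (rule weighted_graph_adjacency)
  have pos: "0 < hdegree H v" for v using H by (simp add: hypergraph_def)
  let ?M = "normalized_laplacian H"
  let ?s = "\<lambda>u. sqrt (hdegree H u)"
  let ?vec = "\<lambda>g. \<chi> u. ?s u * g u"
  have ss: "?s u * (?s u * c) = hdegree H u * c" for u c
    using pos[of u] by (simp add: mult.assoc[symmetric])
  have form: "?vec g \<bullet> (?M *v ?vec g) = energy g" for g
    using pos[THEN less_imp_neq]
    by (simp add: inner_vec_def normalized_laplacian_apply[OF H] energy_green)
  have norm: "?vec g \<bullet> ?vec g = (\<Sum>u\<in>UNIV. hdegree H u * (g u)\<^sup>2)" for g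
    by (simp add: inner_vec_def power2_eq_square mult_ac ss abs_of_pos[OF pos])
  have one: "?vec (\<lambda>u. 1) \<bullet> ?vec g = (\<Sum>u\<in>UNIV. hdegree H u * g u)" for g
    by (simp add: inner_vec_def ss)
  have surj: "\<exists>g. x = ?vec g" for x :: "real^'v"
    using pos[THEN less_imp_neq] by (intro exI[of _ "\<lambda>u. x $ u / ?s u"]) (simp add: vec_eq_iff)
  have psd: "0 \<le> x \<bullet> (?M *v x)" for x
    using surj[of x] form energy_nonneg by metis
  have ker: "?M *v ?vec (\<lambda>u. 1) = 0"
    using normalized_laplacian_apply[OF H, of "\<lambda>u. 1"] by (simp add: vec_eq_iff)
  have "?vec (\<lambda>u. 1) $ w \<noteq> 0" for w using pos[of w] by simp
  then have nz: "?vec (\<lambda>u. 1) \<noteq> 0" by (metis zero_index)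
  have nu: "nu 2 H = eigenvalues ?M ! 1" by (simp add: nu_def)
  note var = second_eigenvalue_variational[OF transpose_normalized_laplacian[OF H] psd ker nz n,
      folded nu]
  show "nu 2 H * (\<Sum>u\<in>UNIV. hdegree H u * (g u)\<^sup>2) \<le> energy g"
    if "(\<Sum>u\<in>UNIV. hdegree H u * g u) = 0"
    using var(1)[of "?vec g"] that unfolding one norm form by simp
  obtain x where x: "x \<noteq> 0" "?vec (\<lambda>u. 1) \<bullet> x = 0" "?M *v x = nu 2 H *\<^sub>R x"
    using var(2) by blast
  obtain g where g: "x = ?vec g" using surj by blast
  have "(\<Sum>v\<in>UNIV. adj H u v * (g u - g v)) = nu 2 H * hdegree H u * g u" for u
  proof -
    have "(?M *v ?vec g) $ u = nu 2 H * (?s u * g u)" using x(3) g by simp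
    then have "(\<Sum>v\<in>UNIV. adj H u v * (g u - g v)) / ?s u = nu 2 H * (?s u * g u)"
      unfolding normalized_laplacian_apply[OF H] .
    moreover have "?s u \<noteq> 0" using pos[of u] by simp
    ultimately have "(\<Sum>v\<in>UNIV. adj H u v * (g u - g v)) = nu 2 H * (?s u * g u) * ?s u"
      by (simp only: nonzero_divide_eq_eq[OF \<open>?s u \<noteq> 0\<close>])
    then show ?thesis using pos[of u] by (simp add: mult_ac abs_of_pos)
  qed
  moreover have "g \<noteq> (\<lambda>u. 0)" using x(1) g by (auto simp: vec_eq_iff)
  ultimately show "\<exists>g. g \<noteq> (\<lambda>u. 0) \<and> (\<Sum>u\<in>UNIV. hdegree H u * g u) = 0
      \<and> (\<forall>u. (\<Sum>v\<in>UNIV. adj H u v * (g u - g v)) = nu 2 H * hdegree H u * g u)"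
    using x(2) one g by metis
qed

text \<open>Choose \<open>a\<close> and \<open>b\<close> without a common hyperedge, and let \<open>g\<close> be supported on them with values
  that make it orthogonal to the constants. As \<open>a\<close> and \<open>b\<close> are not adjacent, the adjacency matrix
  contributes nothing to the energy, which is therefore the weighted norm of \<open>g\<close>.\<close>

lemma non_covering_nu_2_le_1:
  fixes H :: "'v::finite hypergraph"
  assumes H: "hypergraph H" and "\<not> covering H"
  shows "nu 2 H \<le> 1"
proof -
  interpret weighted_graph "adj H" using H by (rule weighted_graph_adjacency)
  have pos: "0 < hdegree H v" for v using H by (simp add: hypergraph_def)
  obtain a b where ab: "a \<noteq> b" "\<And>e. e \<in> edges H \<Longrightarrow> \<not> {a, b} \<subseteq> e"
    using assms(2) by (auto simp: covering_def)
  have n: "2 \<le> CARD('v)"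
    using card_mono[of UNIV "{a, b}"] ab(1) by simp
  have a0: "adj H a b = 0" "adj H b a = 0"
    using ab(2) unfolding adjacency_edge_sum by (auto intro!: sum.neutral)
  have diag0: "adj H u u = 0" for u by (simp add: adjacency_def)
  define g where "g u = (if u = a then hdegree H b else if u = b then - hdegree H a else 0)" for u
  have supp: "(\<Sum>u\<in>UNIV. f u) = f a + f b" if "\<And>u. u \<noteq> a \<Longrightarrow> u \<noteq> b \<Longrightarrow> f u = 0" for f :: "'v \<Rightarrow> real"
  proof -
    have "sum f UNIV = sum f {a, b}" using that by (intro sum.mono_neutral_right) auto
    then show ?thesis using ab(1) by simp
  qed
  have orth: "(\<Sum>u\<in>UNIV. hdegree H u * g u) = 0"
    using ab(1) by (subst supp) (auto simp: g_def)
  have ga: "(\<Sum>v\<in>UNIV. adj H u v * g v) = 0" if "u = a \<or> u = b" for u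
    using that a0 diag0 by (subst supp) (auto simp: g_def)
  have "energy g = (\<Sum>u\<in>UNIV. hdegree H u * (g u)\<^sup>2)"
  proof -
    have "g u * (\<Sum>v\<in>UNIV. adj H u v * (g u - g v)) = hdegree H u * (g u)\<^sup>2" for u
    proof (cases "u = a \<or> u = b")
      case True
      have "(\<Sum>v\<in>UNIV. adj H u v * (g u - g v)) = deg u * g u"
        using ga[OF True] by (simp add: deg_def right_diff_distrib sum_subtractf sum_distrib_right)
      then show ?thesis by (simp add: deg_adjacency[OF H] power2_eq_square)
    qed (simp add: g_def)
    then show ?thesis by (simp add: energy_green)
  qed
  then have "nu 2 H * (\<Sum>u\<in>UNIV. hdegree H u * (g u)\<^sup>2) \<le> 1 * (\<Sum>u\<in>UNIV. hdegree H u * (g u)\<^sup>2)"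
    using nu_2_variational(1)[OF H n orth] by simp
  moreover have "0 < (\<Sum>u\<in>UNIV. hdegree H u * (g u)\<^sup>2)"
    using pos pos[THEN less_imp_neq] by (intro sum_pos2[of _ a]) (auto simp: g_def less_imp_le)
  ultimately show ?thesis by (simp only: mult_le_cancel_right)
qed

section \<open>Conductance and the second eigenvalue\<close>

theorem corollary4p4:
  fixes H :: "'v::finite hypergraph"
  assumes "hypergraph H"
    and "\<not> covering H"
  shows "nu 2 H / real (hrank H) \<le> conductance H
    \<and> conductance H \<le> sqrt ((2 - nu 2 H) * nu 2 H)"
proof -
  note H = assms(1)
  interpret weighted_graph "adj H" using H by (rule weighted_graph_adjacency)
  note deg = deg_adjacency[OF H]
  have pos: "0 < hdegree H v" for v using H by (simp add: hypergraph_def)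
  obtain a b :: 'v where ab: "a \<noteq> b" using assms(2) by (auto simp: covering_def)
  have n: "2 \<le> CARD('v)" using card_mono[of UNIV "{a, b}"] ab by simp
  let ?\<S> = "{S :: 'v set. {} \<subset> S \<and> S \<subset> UNIV}"
  have "{a} \<in> ?\<S>" using ab by auto
  then have ne: "set_conductance H ` ?\<S> \<noteq> {}" by blast
  have vol: "0 < min (sum (hdegree H) S) (sum (hdegree H) (- S))" if "S \<in> ?\<S>" for S
    using that pos by (auto intro!: sum_pos)
  have cond: "set_conductance H S = (\<Sum>e\<in>boundary H S. weight H e) / min (sum deg S) (sum deg (- S))" for S
    by (simp add: set_conductance_def vol_def deg Compl_eq_Diff_UNIV)
  have w: "0 \<le> (\<Sum>e\<in>boundary H S. weight H e)" for S
    using H by (intro sum_nonneg) (auto simp: boundary_def hypergraph_def)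

  obtain g where g: "g \<noteq> (\<lambda>u. 0)" "(\<Sum>u\<in>UNIV. deg u * g u) = 0"
      "\<And>u. (\<Sum>v\<in>UNIV. adj H u v * (g u - g v)) = nu 2 H * deg u * g u"
    using nu_2_variational(2)[OF H n] unfolding deg by blast
  \<comment> \<open>The eigenvalue is the Rayleigh quotient of its eigenvector.\<close>
  have "0 \<le> nu 2 H"
  proof -
    obtain w where w: "g w \<noteq> 0" using g(1) by auto
    have "energy g = nu 2 H * (\<Sum>u\<in>UNIV. deg u * (g u)\<^sup>2)"
      unfolding energy_green g(3) by (simp add: sum_distrib_left power2_eq_square mult_ac)
    moreover have "0 < (\<Sum>u\<in>UNIV. deg u * (g u)\<^sup>2)"
      using pos w by (intro sum_pos2[of _ w]) (auto simp: deg less_imp_le)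
    ultimately show ?thesis using energy_nonneg[of g] by (simp add: zero_le_mult_iff)
  qed

  have "conductance H \<in> set_conductance H ` ?\<S>"
    unfolding conductance_def using ne by (intro Min_in) auto
  then obtain S where S: "S \<in> ?\<S>" "conductance H = set_conductance H S" by auto
  let ?m = "min (sum deg S) (sum deg (- S))" and ?w = "\<Sum>e\<in>boundary H S. weight H e"
  have m: "0 < ?m" using vol[OF S(1)] by (simp add: deg)
  have "nu 2 H * ?m \<le> 2 * cut S"
    using S(1) pos nu_2_variational(1)[OF H n] \<open>0 \<le> nu 2 H\<close>
    by (intro rayleigh_cut_bound) (auto simp: deg)
  also have "\<dots> \<le> real (hrank H) * ?w"
    using boundary_weight_cut_bounds(2)[OF H, of S] by simp
  finally have "nu 2 H * ?m \<le> real (hrank H) * ?w" .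
  moreover have "0 < hrank H"
  proof -
    have "hdegree H a \<noteq> 0" using pos[of a] by simp
    then obtain e where e: "e \<in> edges H"
      unfolding hdegree_def by (metis (mono_tags, lifting) mem_Collect_eq sum.neutral)
    then have "2 \<le> card e" using H by (simp add: hypergraph_def)
    also have "card e \<le> hrank H" using e by (simp add: hrank_def)
    finally show ?thesis by simp
  qed
  ultimately have lower: "nu 2 H / real (hrank H) \<le> conductance H"
    using m by (simp add: S(2) cond field_simps)

  have "0 \<le> conductance H" using w m by (simp add: S(2) cond)
  moreover have "conductance H * min (sum deg T) (sum deg (- T)) \<le> cut T"
    if "T \<noteq> {}" "T \<noteq> UNIV" for T
  proof -
    have T: "T \<in> ?\<S>" using that by auto
    then have "conductance H \<le> set_conductance H T"
      unfolding conductance_def by (intro Min_le) auto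
    then have "conductance H * min (sum deg T) (sum deg (- T)) \<le> (\<Sum>e\<in>boundary H T. weight H e)"
      using vol[OF T] unfolding cond deg by (simp only: pos_le_divide_eq)
    also have "\<dots> \<le> cut T" using H by (rule boundary_weight_cut_bounds)
    finally show ?thesis .
  qed
  ultimately have "(conductance H)\<^sup>2 \<le> (2 - nu 2 H) * nu 2 H"
    using g non_covering_nu_2_le_1[OF assms] pos
    by (intro cheeger_inequality[of _ g]) (auto simp: deg)
  then show ?thesis using lower by (simp add: real_le_rsqrt)
qed

end
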